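(* Let $A\in\mathbb{R}^{m\times n}$, $b\in\mathbb{R}^m$, $p\in\{1,2\}$, and let $\phi(z):=\frac1p z^p$ for $z\ge 0$. Let $L$, $s_i,\rho_i,\Omega_i$ ($i\in\mathbb{N}_L^0$) and $K$, $\Lambda_i$ ($i=-1,0,\dots,K-1$), $t_i,\lambda_i$ ($i\in\mathbb{N}_K^0$) be produced by Iterations 1 and 2 of the context for this $\phi$. Let $\lambda_{-1}:=+\infty$ and $T:=\{t_i:i\in\mathbb{N}_K^0\}$. Let $\sigma^*:=\min\{\|Ax-b\|_p:x\in\mathbb{R}^n\}$; for real $\lambda>0$ let $\Omega(\lambda):=\arg\min\{\|x\|_0+\lambda\phi(\|Ax-b\|_p):x\in\mathbb{R}^n\}$; for $\sigma\ge\sigma^*$ let $\widehat\Omega(\sigma):=\arg\min\{\|x\|_0:\|Ax-b\|_p\le\sigma,\ x\in\mathbb{R}^n\}$. For $\sigma\in[\sigma^*,\|b\|_p)$, let $k\in\mathbb{N}_{L-1}^0$ be the integer such that $\rho_k\le\phi(\sigma)<\rho_{k+1}$. Below $\lambda$ ranges over the positive reals. (i) If $k\in T$, say $k=t_j$, then: $\Omega(\lambda)\subseteq\widehat\Omega(\sigma)$ if $\lambda\in(\lambda_j,\lambda_{j-1})$; $\Omega(\lambda)\cap\widehat\Omega(\sigma)=\Omega_k$ if $\lambda=\lambda_j$ or $\lambda=\lambda_{j-1}$; and $\Omega(\lambda)\cap\widehat\Omega(\sigma)=\emptyset$ otherwise. Further, if $\phi(\sigma)=\rho_k$, then $\Omega(\lambda)=\widehat\Omega(\sigma)$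 for $\lambda\in(\lambda_j,\lambda_{j-1})$ and $\widehat\Omega(\sigma)\subsetneq\Omega(\lambda)$ for $\lambda=\lambda_j,\lambda_{j-1}$. (ii) If $k\in\left(\bigcup_{i=-1}^{K-1}\Lambda_i\right)\setminus T$, say $k\in\Lambda_j$, then $\Omega(\lambda)\cap\widehat\Omega(\sigma)=\Omega_k$ if $\lambda=\lambda_j$, and $\Omega(\lambda)\cap\widehat\Omega(\sigma)=\emptyset$ otherwise. (iii) If $k\notin\bigcup_{i=-1}^{K-1}\Lambda_i$, then $\Omega(\lambda)\cap\widehat\Omega(\sigma)=\emptyset$ for any $\lambda>0$.
   Context: $\mathbb{N}_k^0=\{0,1,\dots,k\}$; $\|x\|_0$ is the number of nonzero components of $x$; $\arg\min$, $\arg\max$ denote the sets of all global minimizers/maximizers. Iteration 1 (depending on $A,b,p,\phi$). Set $i=0$ and $\rho_0:=\min\{\phi(\|Ax-b\|_p):x\in\mathbb{R}^n\}$, $s_0:=\min\{\|x\|_0:\phi(\|Ax-b\|_p)=\rho_0,\ x\in\mathbb{R}^n\}$, $\Omega_0:=\arg\min\{\|x\|_0:\phi(\|Ax-b\|_p)=\rho_0,\ x\in\mathbb{R}^n\}$. While $s_i>0$: put $\rho_{i+1}:=\min\{\phi(\|Ax-b\|_p):\|x\|_0\le s_i-1,\ x\in\mathbb{R}^n\}$, $s_{i+1}:=\min\{\|x\|_0:\phi(\|Ax-b\|_p)=\rho_{i+1},\ x\in\mathbb{R}^n\}$, $\Omega_{i+1}:=\arg\min\{\|x\|_0:\phi(\|Ax-b\|_p)=\rho_{i+1},\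 x\in\mathbb{R}^n\}$, and replace $i$ by $i+1$. When the loop ends (i.e. $s_i=0$), set $L:=i$. (All these minima are attained and the iteration terminates.) Iteration 2. Set $i=0$ and $\Lambda_{-1}:=\{0\}$. While $L\notin\Lambda_{i-1}$: put $t_i:=\max\Lambda_{i-1}$, $\lambda_i:=\max\{\frac{s_{t_i}-s_j}{\rho_j-\rho_{t_i}}:j=t_i+1,\dots,L\}$, $\Lambda_i:=\arg\max\{\frac{s_{t_i}-s_j}{\rho_j-\rho_{t_i}}:j=t_i+1,\dots,L\}$ (a set of indices $j$), and replace $i$ by $i+1$. When the loop ends, set $K:=i$, $t_K:=L$, $\lambda_K:=0$. *)

theory Defs
  imports "HOL-Analysis.Analysis"
begin

definition l0 :: "real ^ 'n \<Rightarrow> nat" where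
  "l0 x = card {i. x $ i \<noteq> 0}"

definition pnorm :: "nat \<Rightarrow> real ^ 'm \<Rightarrow> real" where
  "pnorm p y = root p (\<Sum>i\<in>UNIV. \<bar>y $ i\<bar> ^ p)"

definition phi :: "nat \<Rightarrow> real \<Rightarrow> real" where
  "phi p z = (1 / real p) * z ^ p"

text \<open>The minimum itself, not an infimum: the value is only specified if it is attained.\<close>
definition min_on :: "('a \<Rightarrow> 'b::linorder) \<Rightarrow> 'a set \<Rightarrow> 'b" where
  "min_on f S = (LEAST v. v \<in> f ` S)"

definition argmin_on :: "('a \<Rightarrow> 'b::linorder) \<Rightarrow> 'a set \<Rightarrow> 'a set" where
  "argmin_on f S = {x. is_arg_min f (\<lambda>y. y \<in> S) x}"

definition argmax_on :: "('a \<Rightarrow> 'b::linorder) \<Rightarrow> 'a set \<Rightarrow> 'a set" where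
  "argmax_on f S = {x. is_arg_max f (\<lambda>y. y \<in> S) x}"

text \<open>
  First iteration. The data \<open>A\<close>, \<open>b\<close>, \<open>p\<close>, \<open>\<phi>\<close> enter only through the function
  \<open>g x = \<phi> (\<parallel>A x - b\<parallel>\<^sub>p)\<close>, so \<open>g\<close> is the parameter.
  The loop is run forever here; only the entries with index at most \<open>L_idx g\<close> are meaningful,
  and for these the truncated subtraction is only ever applied to a positive number.
\<close>

definition min_l0_level :: "(real ^ 'n \<Rightarrow> real) \<Rightarrow> real \<Rightarrow> nat" where
  "min_l0_level g r = min_on l0 {x. g x = r}"

fun rho :: "(real ^ 'n \<Rightarrow> real) \<Rightarrow> nat \<Rightarrow> real" where
  "rho g 0 = min_on g UNIV"
| "rho g (Suc i) = min_on g {x. l0 x \<le> min_l0_level g (rho g i) - 1}"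

definition s_seq :: "(real ^ 'n \<Rightarrow> real) \<Rightarrow> nat \<Rightarrow> nat" where
  "s_seq g i = min_l0_level g (rho g i)"

definition Omega_seq :: "(real ^ 'n \<Rightarrow> real) \<Rightarrow> nat \<Rightarrow> (real ^ 'n) set" where
  "Omega_seq g i = argmin_on l0 {x. g x = rho g i}"

definition L_idx :: "(real ^ 'n \<Rightarrow> real) \<Rightarrow> nat" where
  "L_idx g = (LEAST i. s_seq g i = 0)"

definition slope :: "(real ^ 'n \<Rightarrow> real) \<Rightarrow> nat \<Rightarrow> nat \<Rightarrow> real" where
  "slope g t j = (real (s_seq g t) - real (s_seq g j)) / (rho g j - rho g t)"

text \<open>
  Second iteration. \<open>Lambda_pre g i\<close> is \<open>\<Lambda>\<^bsub>i-1\<^esub>\<close>, so that the recursion starts at \<open>0\<close>;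
  \<open>Lambda_set\<close> and \<open>lambda_val\<close> take an integer index starting at \<open>-1\<close>.
  Again only the entries up to the termination index \<open>K_idx g\<close> are meaningful.
\<close>

fun Lambda_pre :: "(real ^ 'n \<Rightarrow> real) \<Rightarrow> nat \<Rightarrow> nat set" where
  "Lambda_pre g 0 = {0}"
| "Lambda_pre g (Suc i) =
     (let t = Max (Lambda_pre g i) in argmax_on (slope g t) {t + 1..L_idx g})"

definition Lambda_set :: "(real ^ 'n \<Rightarrow> real) \<Rightarrow> int \<Rightarrow> nat set" where
  "Lambda_set g i = Lambda_pre g (nat (i + 1))"

definition K_idx :: "(real ^ 'n \<Rightarrow> real) \<Rightarrow> nat" where
  "K_idx g = (LEAST i. L_idx g \<in> Lambda_set g (int i - 1))"

definition t_seq :: "(real ^ 'n \<Rightarrow> real) \<Rightarrow> nat \<Rightarrow> nat" where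
  "t_seq g i = (if i < K_idx g then Max (Lambda_set g (int i - 1)) else L_idx g)"

definition lambda_val :: "(real ^ 'n \<Rightarrow> real) \<Rightarrow> int \<Rightarrow> ereal" where
  "lambda_val g i =
     (if i < 0 then \<infinity>
      else if i < int (K_idx g)
        then ereal (Max (slope g (t_seq g (nat i)) ` {t_seq g (nat i) + 1..L_idx g}))
      else 0)"

definition T_set :: "(real ^ 'n \<Rightarrow> real) \<Rightarrow> nat set" where
  "T_set g = t_seq g ` {0..K_idx g}"

definition Omega_reg :: "(real ^ 'n \<Rightarrow> real) \<Rightarrow> real \<Rightarrow> (real ^ 'n) set" where
  "Omega_reg g l = argmin_on (\<lambda>x. real (l0 x) + l * g x) UNIV"

definition Omega_con :: "real ^ 'n ^ 'm \<Rightarrow> real ^ 'm \<Rightarrow> nat \<Rightarrow> real \<Rightarrow> (real ^ 'n) set" where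
  "Omega_con A b p \<sigma> = argmin_on l0 {x. pnorm p (A *v x - b) \<le> \<sigma>}"

definition sigma_star :: "real ^ 'n ^ 'm \<Rightarrow> real ^ 'm \<Rightarrow> nat \<Rightarrow> real" where
  "sigma_star A b p = min_on (\<lambda>x. pnorm p (A *v x - b)) UNIV"

end

theory Submission
  imports Defs
begin

text \<open>
  Every point \<open>x\<close> is dominated in \<open>(\<parallel>x\<parallel>\<^sub>0, g x)\<close> by one of the finitely many pairs
  \<open>(s\<^sub>k, \<rho>\<^sub>k)\<close>, and \<open>\<Omega>\<^sub>k\<close> is the set of points attaining such a pair. Hence \<open>\<Omega>(\<lambda>)\<close> is the
  disjoint union of the \<open>\<Omega>\<^sub>k\<close> over the indices \<open>k\<close> minimising the affine function
  \<open>s\<^sub>k + \<lambda> \<rho>\<^sub>k\<close>, while the points of \<open>\<Omega>\<close>-hat\<open>(\<sigma>)\<close> all have \<open>\<parallel>x\<parallel>\<^sub>0 = s\<^sub>k\<close> for the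
  index \<open>k\<close> bracketing \<open>\<phi>(\<sigma>)\<close>; so the two sets meet, in exactly \<open>\<Omega>\<^sub>k\<close>, iff \<open>k\<close> is such a
  minimiser. The second iteration walks along the lower envelope of these lines from large to
  small \<open>\<lambda>\<close>: \<open>t\<^sub>i\<close> is the index of the \<open>i\<close>-th line on it, \<open>\<lambda>\<^sub>i\<close> the breakpoint to the next one, and
  \<open>\<Lambda>\<^sub>i\<close> collects the later lines through that breakpoint.
\<close>

section \<open>Extremal sets from a known extremal point\<close>

lemma min_on_eqI:
  assumes "x \<in> S" "\<And>y. y \<in> S \<Longrightarrow> f x \<le> f y"
  shows "min_on f S = f x"
  unfolding min_on_def using assms by (intro Least_equality) auto

lemma argmin_on_eq: "argmin_on f S = {x \<in> S. \<forall>y\<in>S. f x \<le> f y}"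
  unfolding argmin_on_def is_arg_min_def by (auto simp: not_less)

lemma argmax_on_eqI:
  assumes "z \<in> S" "\<And>y. y \<in> S \<Longrightarrow> f y \<le> f z"
  shows "argmax_on f S = {x \<in> S. f x = f z}"
proof -
  have "argmax_on f S = {x \<in> S. \<forall>y\<in>S. f y \<le> f x}"
    unfolding argmax_on_def is_arg_max_def by (auto simp: not_less)
  with assms show ?thesis by (auto intro: antisym)
qed

lemma argmin_on_eqI:
  assumes "z \<in> S" "\<And>y. y \<in> S \<Longrightarrow> f z \<le> f y"
  shows "argmin_on f S = {x \<in> S. f x = f z}"
  using assms by (auto simp: argmin_on_eq intro: antisym)

lemma l0_eq_0_iff: "l0 x = 0 \<longleftrightarrow> x = 0"
  unfolding l0_def by (auto simp: vec_eq_iff)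

lemma l0_le_CARD: "l0 (x :: real ^ 'n) \<le> CARD('n)"
  unfolding l0_def by (intro card_mono) auto

declare rho.simps(2) [simp del] Lambda_pre.simps(2) [simp del]

section \<open>Sparsity levels and their minimal residuals\<close>

text \<open>Attainment at every sparsity level is the only analytic input. Everything inside the
  locale is combinatorics of the pairs \<open>(s k, \<rho> k)\<close>, independent of
  \<open>A\<close>, \<open>b\<close> and \<open>p\<close>.\<close>

locale sparse_attaining =
  fixes g :: "real ^ 'n \<Rightarrow> real"
  assumes attained: "\<exists>x. l0 x \<le> k \<and> (\<forall>y. l0 y \<le> k \<longrightarrow> g x \<le> g y)"
begin

abbreviation "L \<equiv> L_idx g"
abbreviation "s \<equiv> s_seq g"
abbreviation "\<rho> \<equiv> rho g"

lemma rho_0_attained: "\<exists>x. g x = \<rho> 0 \<and> (\<forall>y. g x \<le> g y)"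
proof -
  obtain x where "\<forall>y. l0 y \<le> CARD('n) \<longrightarrow> g x \<le> g y"
    using attained by blast
  then have "\<forall>y. g x \<le> g y" using l0_le_CARD by blast
  then show ?thesis using min_on_eqI[of x UNIV g] by auto
qed

text \<open>Also valid beyond the end of the loop: once \<open>s i = 0\<close>, truncated
  subtraction leaves level 0, where the minimum is still attained.\<close>

lemma rho_Suc_attained:
  "\<exists>x. l0 x \<le> s i - 1 \<and> g x = \<rho> (Suc i) \<and> (\<forall>y. l0 y \<le> s i - 1 \<longrightarrow> g x \<le> g y)"
proof -
  obtain x where x: "l0 x \<le> s i - 1" "\<forall>y. l0 y \<le> s i - 1 \<longrightarrow> g x \<le> g y"
    using attained by blast
  then have "\<rho> (Suc i) = g x"
    using min_on_eqI[of x "{x. l0 x \<le> s i - 1}" g] by (simp add: s_seq_def rho.simps(2))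
  with x show ?thesis by auto
qed

lemma rho_attained: "\<exists>x. g x = \<rho> i"
  using rho_0_attained rho_Suc_attained by (metis not0_implies_Suc)

lemma s_attained: "\<exists>x. g x = \<rho> i \<and> l0 x = s i"
  and s_le_l0: "g x = \<rho> i \<Longrightarrow> s i \<le> l0 x"
proof -
  have s: "s i = (LEAST v. v \<in> l0 ` {x. g x = \<rho> i})"
    by (simp add: s_seq_def min_l0_level_def min_on_def)
  obtain z where "g z = \<rho> i" using rho_attained by blast
  then have "s i \<in> l0 ` {x. g x = \<rho> i}"
    unfolding s by (intro LeastI) auto
  then show "\<exists>x. g x = \<rho> i \<and> l0 x = s i" by auto
  show "s i \<le> l0 x" if "g x = \<rho> i" unfolding s using that by (intro Least_le) auto
qed

lemma Omega_seq_eq: "Omega_seq g i = {x. g x = \<rho> i \<and> l0 x = s i}"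
proof -
  obtain z where "g z = \<rho> i" "l0 z = s i" using s_attained by blast
  then show ?thesis
    using argmin_on_eqI[of z "{x. g x = \<rho> i}" l0] s_le_l0 by (simp add: Omega_seq_def)
qed

lemma Omega_seq_nonempty: "Omega_seq g i \<noteq> {}"
  using s_attained by (auto simp: Omega_seq_eq)

lemma s_Suc_le: "s (Suc i) \<le> s i - 1"
  using rho_Suc_attained[of i] s_le_l0 by (metis le_trans)

text \<open>The recursion minimises over the level \<open>s (i - 1) - 1\<close>; this level contains
  all points of sparsity at most \<open>s i\<close>, because \<open>s\<close> drops at each
  step.\<close>

lemma rho_le:
  assumes "l0 x \<le> s i" shows "\<rho> i \<le> g x"
proof (cases i)
  case 0 then show ?thesis using rho_0_attained by metis
next
  case (Suc i')
  then have "l0 x \<le> s i' - 1" using s_Suc_le assms le_trans by blast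
  then show ?thesis using rho_Suc_attained[of i'] Suc by metis
qed

text \<open>Termination of the first iteration: \<open>s\<close> loses at least one per step while
  positive, so it vanishes at index \<open>s 0\<close> at the latest.\<close>

lemma s_L: "s L = 0"
proof -
  have "s i \<le> s 0 - i" for i
  proof (induction i)
    case (Suc i) then show ?case using s_Suc_le[of i] by linarith
  qed auto
  from this[of "s 0"] have "s (s 0) = 0" by simp
  then show ?thesis unfolding L_idx_def by (rule LeastI)
qed

lemma s_pos: "i < L \<Longrightarrow> 0 < s i"
  unfolding L_idx_def by (auto dest: not_less_Least)

lemma s_less_l0:
  assumes "g x < \<rho> (Suc i)" shows "s i \<le> l0 x"
proof (rule ccontr)
  assume "\<not> s i \<le> l0 x"
  then have "l0 x \<le> s i - 1" by linarith
  then show False using rho_Suc_attained[of i] assms by (metis not_less)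
qed

text \<open>A point attaining \<open>\<rho> (Suc i)\<close> is sparser than \<open>s i\<close>. It
  lies in a level where \<open>\<rho> i\<close> is a lower bound, but residual
  \<open>\<rho> i\<close> itself would contradict the minimality of \<open>s i\<close>.\<close>

lemma rho_Suc_less:
  assumes "i < L" shows "\<rho> i < \<rho> (Suc i)"
proof -
  obtain x where x: "l0 x \<le> s i - 1" "g x = \<rho> (Suc i)" using rho_Suc_attained by blast
  then have "l0 x < s i" using s_pos[OF assms] by linarith
  then have "\<rho> i \<le> g x" "g x \<noteq> \<rho> i" using rho_le[of x i] s_le_l0[of x i] by auto
  then show ?thesis using x by simp
qed

lemma rho_less:
  assumes "i < j" "j \<le> L" shows "\<rho> i < \<rho> j"
  using assms
proof (induction j)
  case (Suc j)
  have "\<rho> j < \<rho> (Suc j)" using rho_Suc_less Suc.prems by simp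
  moreover have "i = j \<or> \<rho> i < \<rho> j" using Suc by (auto simp: less_Suc_eq)
  ultimately show ?case by auto
qed simp

lemma s_less:
  assumes "i < j" "j \<le> L" shows "s j < s i"
  using assms
proof (induction j)
  case (Suc j)
  have "s (Suc j) < s j" using s_Suc_le[of j] s_pos[of j] Suc.prems by linarith
  moreover have "i = j \<or> s j < s i" using Suc by (auto simp: less_Suc_eq)
  ultimately show ?case by auto
qed simp

lemma s_inj: "i \<le> L \<Longrightarrow> j \<le> L \<Longrightarrow> s i = s j \<Longrightarrow> i = j"
  using s_less[of i j] s_less[of j i] by (cases i j rule: linorder_cases) auto

lemma rho_L: "\<rho> L = g 0"
proof -
  obtain x where "g x = \<rho> L" "l0 x = s L" using s_attained by blast
  then show ?thesis by (simp add: s_L l0_eq_0_iff)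
qed

lemma bracket_exists:
  assumes "\<rho> 0 \<le> r" "r < \<rho> L"
  shows "\<exists>k<L. \<rho> k \<le> r \<and> r < \<rho> (Suc k)"
proof -
  define j where "j = (LEAST j. r < \<rho> j)"
  have j: "r < \<rho> j" unfolding j_def using assms by (intro LeastI)
  have "j \<le> L" unfolding j_def using assms by (intro Least_le)
  moreover obtain k where k: "j = Suc k" using j assms by (cases j) auto
  moreover have "\<not> r < \<rho> k" using not_less_Least[of k "\<lambda>j. r < \<rho> j"] k j_def by auto
  ultimately show ?thesis using j by (intro exI[of _ k]) auto
qed

lemma bracket_unique:
  assumes "k < L" "\<rho> k \<le> r" "r < \<rho> (Suc k)" "i < L" "\<rho> i \<le> r" "r < \<rho> (Suc i)"
  shows "i = k"
proof (rule ccontr)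
  have *: False if "a < b" "b < L" "r < \<rho> (Suc a)" "\<rho> b \<le> r" for a b
    using that rho_less[of "Suc a" b] by (cases "Suc a = b") auto
  assume "i \<noteq> k"
  then show False using *[of i k] *[of k i] assms by linarith
qed

text \<open>The index brackets \<open>g x\<close> between consecutive values of
  \<open>\<rho>\<close>, and \<open>s_less_l0\<close> bounds the sparsity. From
  \<open>\<rho> L\<close> upwards the index \<open>L\<close> serves, since
  \<open>s L = 0\<close>.\<close>

lemma dominated: "\<exists>k\<le>L. \<rho> k \<le> g x \<and> s k \<le> l0 x"
proof (cases "g x < \<rho> L")
  case True
  moreover have "\<rho> 0 \<le> g x" using rho_0_attained by metis
  ultimately obtain k where "k < L" "\<rho> k \<le> g x" "g x < \<rho> (Suc k)"
    using bracket_exists by blast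
  then show ?thesis using s_less_l0[of x k] by (intro exI[of _ k]) auto
next
  case False then show ?thesis by (intro exI[of _ L]) (auto simp: s_L)
qed

section \<open>Both optimisation problems in terms of the levels\<close>

lemma constrained_eq:
  assumes "k < L" "\<rho> k \<le> r" "r < \<rho> (Suc k)"
  shows "argmin_on l0 {x. g x \<le> r} = {x. g x \<le> r \<and> l0 x = s k}"
proof -
  obtain z where "g z = \<rho> k" "l0 z = s k" using s_attained by blast
  moreover have "s k \<le> l0 x" if "g x \<le> r" for x using s_less_l0 that assms by force
  ultimately show ?thesis using argmin_on_eqI[of z "{x. g x \<le> r}" l0] assms by simp
qed

text \<open>No point of sparsity \<open>s k\<close> has residual below \<open>\<rho> k\<close>, so
  the constraint is tight at every minimiser.\<close>

lemma constrained_at_level: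
  assumes "k < L"
  shows "argmin_on l0 {x. g x \<le> \<rho> k} = Omega_seq g k"
proof -
  have "g x \<le> \<rho> k \<longleftrightarrow> g x = \<rho> k" if "l0 x = s k" for x
    using rho_le[of x k] that by auto
  then show ?thesis
    using constrained_eq[OF assms order_refl rho_Suc_less[OF assms]] by (auto simp: Omega_seq_eq)
qed

text \<open>The penalised objective on \<open>Omega_seq g k\<close>. As a function of
  \<open>l\<close> it is a line with gradient \<open>\<rho> k\<close>; \<open>slope g i j\<close> is
  not a gradient but the abscissa where the lines \<open>i\<close> and \<open>j\<close>
  cross.\<close>

definition cost :: "real \<Rightarrow> nat \<Rightarrow> real" where
  "cost l k = real (s k) + l * \<rho> k"

definition opt :: "real \<Rightarrow> nat set" where
  "opt l = {k. k \<le> L \<and> (\<forall>i\<le>L. cost l k \<le> cost l i)}"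

lemma Omega_reg_eq:
  assumes "0 < l" shows "Omega_reg g l = (\<Union>k\<in>opt l. Omega_seq g k)"
proof -
  let ?h = "\<lambda>x. real (l0 x) + l * g x"
  have h: "?h x = cost l k" if "x \<in> Omega_seq g k" for x k
    using that by (simp add: Omega_seq_eq cost_def)
  \<comment> \<open>Domination with its equality case: as \<open>l\<close> is positive, equal costs
    force equality in both coordinates.\<close>
  have dom: "\<exists>k\<le>L. cost l k \<le> ?h x \<and> (cost l k = ?h x \<longrightarrow> x \<in> Omega_seq g k)" for x
  proof -
    obtain k where k: "k \<le> L" "\<rho> k \<le> g x" "s k \<le> l0 x" using dominated by blast
    have le: "l * \<rho> k \<le> l * g x" "real (s k) \<le> real (l0 x)" using k assms by simp_all
    have "x \<in> Omega_seq g k" if "cost l k = ?h x"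
    proof -
      have "real (s k) = real (l0 x)" "l * \<rho> k = l * g x"
        using that le unfolding cost_def by linarith+
      then show ?thesis using assms by (simp add: Omega_seq_eq)
    qed
    then show ?thesis using k le by (intro exI[of _ k]) (auto simp: cost_def intro: add_mono)
  qed
  show ?thesis
  proof (intro set_eqI iffI)
    fix x assume "x \<in> Omega_reg g l"
    then have x: "?h x \<le> ?h y" for y by (simp add: Omega_reg_def argmin_on_eq)
    obtain k where k: "k \<le> L" "cost l k \<le> ?h x" "cost l k = ?h x \<longrightarrow> x \<in> Omega_seq g k"
      using dom by blast
    have min: "?h x \<le> cost l i" for i
    proof -
      obtain y where "y \<in> Omega_seq g i" using Omega_seq_nonempty by blast
      then show ?thesis using x[of y] h[of y i] by simp
    qed
    then have "cost l k = ?h x" using k by (intro antisym) auto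
    then show "x \<in> (\<Union>k\<in>opt l. Omega_seq g k)" using k min by (auto simp: opt_def)
  next
    fix x assume "x \<in> (\<Union>k\<in>opt l. Omega_seq g k)"
    then obtain k where k: "k \<in> opt l" "x \<in> Omega_seq g k" by blast
    have "?h x \<le> ?h y" for y
    proof -
      obtain i where "i \<le> L" "cost l i \<le> ?h y" using dom by blast
      moreover have "cost l k \<le> cost l i" using k(1) \<open>i \<le> L\<close> by (simp add: opt_def)
      ultimately show ?thesis using h[OF k(2)] by simp
    qed
    then show "x \<in> Omega_reg g l" by (simp add: Omega_reg_def argmin_on_eq)
  qed
qed

text \<open>Constrained minimisers have sparsity \<open>s k\<close>, and \<open>s\<close> is
  injective up to \<open>L\<close>, so among the pieces of \<open>Omega_reg g l\<close> only the one
  with index \<open>k\<close> can meet them.\<close>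

lemma reg_inter_constrained:
  assumes "0 < l" "k < L" "\<rho> k \<le> r" "r < \<rho> (Suc k)"
  shows "Omega_reg g l \<inter> argmin_on l0 {x. g x \<le> r} = (if k \<in> opt l then Omega_seq g k else {})"
proof -
  have "i = k" if "i \<in> opt l" "s i = s k" for i using s_inj that assms by (auto simp: opt_def)
  moreover have "l0 x = s i" if "x \<in> Omega_seq g i" for x i using that by (simp add: Omega_seq_eq)
  ultimately have "x \<in> Omega_reg g l \<and> l0 x = s k \<longleftrightarrow> k \<in> opt l \<and> x \<in> Omega_seq g k" for x
    unfolding Omega_reg_eq[OF assms(1)] by (metis UN_E UN_I)
  then show ?thesis unfolding constrained_eq[OF assms(2-)]
    using assms by (auto simp: Omega_seq_eq)
qed

section \<open>The lower envelope of the cost lines\<close>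

text \<open>Together with \<open>breakpoint\<close>, a real-valued, naturally indexed form of the
  second iteration without case splits at \<open>K\<close>; \<open>t_seq_eq\<close> and
  \<open>lambda_val_eq\<close> give the agreement. \<open>Lambda_pre g i\<close> carries the shifted
  index, so the vertex belongs to Lambda with index \<open>i - 1\<close>.\<close>

definition vertex :: "nat \<Rightarrow> nat" where
  "vertex i = Max (Lambda_pre g i)"

definition breakpoint :: "nat \<Rightarrow> real" where
  "breakpoint i = Max (slope g (vertex i) ` {vertex i + 1..L})"

abbreviation "K \<equiv> K_idx g"

text \<open>The factor \<open>\<rho> j - \<rho> i\<close> is positive, so the order of two lines
  depends only on the side of their crossing: larger \<open>l\<close> favours the smaller
  index.\<close>

lemma cost_diff:
  assumes "i < j" "j \<le> L"
  shows "cost l j - cost l i = (\<rho> j - \<rho> i) * (l - slope g i j)"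
  using rho_less[OF assms] by (simp add: slope_def cost_def field_simps)

lemma cost_less_iff:
  assumes "i < j" "j \<le> L"
  shows "cost l i < cost l j \<longleftrightarrow> slope g i j < l"
    and "cost l j < cost l i \<longleftrightarrow> l < slope g i j"
proof -
  have "0 < \<rho> j - \<rho> i" using rho_less[OF assms] by simp
  then have "0 < cost l j - cost l i \<longleftrightarrow> 0 < l - slope g i j"
    and "cost l j - cost l i < 0 \<longleftrightarrow> l - slope g i j < 0"
    unfolding cost_diff[OF assms] by (simp_all add: zero_less_mult_iff mult_less_0_iff)
  then show "cost l i < cost l j \<longleftrightarrow> slope g i j < l"
    and "cost l j < cost l i \<longleftrightarrow> l < slope g i j" by simp_all
qed

lemma cost_le_iff:
  assumes "i < j" "j \<le> L"
  shows "cost l i \<le> cost l j \<longleftrightarrow> slope g i j \<le> l"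
    and "cost l j \<le> cost l i \<longleftrightarrow> l \<le> slope g i j"
  using cost_less_iff[OF assms] by (simp_all only: not_less[symmetric])

section \<open>Well-definedness and termination of the second iteration\<close>

lemma slope_le_breakpoint: "vertex i < j \<Longrightarrow> j \<le> L \<Longrightarrow> slope g (vertex i) j \<le> breakpoint i"
  unfolding breakpoint_def by (intro Max_ge) auto

lemma Lambda_pre_Suc_eq:
  assumes "vertex i < L"
  shows "Lambda_pre g (Suc i) = {j. vertex i < j \<and> j \<le> L \<and> slope g (vertex i) j = breakpoint i}"
    and "Lambda_pre g (Suc i) \<noteq> {}"
proof -
  have "breakpoint i \<in> slope g (vertex i) ` {vertex i + 1..L}"
    unfolding breakpoint_def using assms by (intro Max_in) auto
  then obtain z where z: "z \<in> {vertex i + 1..L}" "slope g (vertex i) z = breakpoint i"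
    by force
  have step: "Lambda_pre g (Suc i) = argmax_on (slope g (vertex i)) {vertex i + 1..L}"
    by (simp add: vertex_def Let_def Lambda_pre.simps(2))
  have argmax: "argmax_on (slope g (vertex i)) {vertex i + 1..L}
      = {j \<in> {vertex i + 1..L}. slope g (vertex i) j = slope g (vertex i) z}"
    using slope_le_breakpoint[of i] z by (intro argmax_on_eqI) auto
  show *: "Lambda_pre g (Suc i)
      = {j. vertex i < j \<and> j \<le> L \<and> slope g (vertex i) j = breakpoint i}"
    unfolding step argmax z(2) by (intro Collect_cong) (simp add: Suc_le_eq)
  have "z \<in> Lambda_pre g (Suc i)" unfolding * using z by simp
  then show "Lambda_pre g (Suc i) \<noteq> {}" by blast
qed

text \<open>Phrased without \<open>K\<close>, since it serves to prove that the loop stops. The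
  growth \<open>i \<le> vertex i\<close> inside \<open>{..L}\<close> rules out an endless
  run.\<close>

lemma Lambda_pre_invariant:
  assumes "\<And>j. j < i \<Longrightarrow> L \<notin> Lambda_pre g j"
  shows "Lambda_pre g i \<subseteq> {..L} \<and> vertex i \<in> Lambda_pre g i \<and> i \<le> vertex i"
  using assms
proof (induction i)
  case 0 then show ?case by (simp add: vertex_def)
next
  case (Suc i)
  then have IH: "Lambda_pre g i \<subseteq> {..L}" "vertex i \<in> Lambda_pre g i" "i \<le> vertex i" by auto
  moreover have "vertex i \<noteq> L" using IH(2) Suc.prems[of i] by auto
  ultimately have less: "vertex i < L" by fastforce
  note eq = Lambda_pre_Suc_eq[OF less]
  have "finite (Lambda_pre g (Suc i))" unfolding eq(1) by simp
  then have in': "vertex (Suc i) \<in> Lambda_pre g (Suc i)"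
    using Max_in eq(2) by (simp only: vertex_def)
  then have "vertex i < vertex (Suc i)" unfolding eq(1) by blast
  moreover have "Lambda_pre g (Suc i) \<subseteq> {..L}" unfolding eq(1) by auto
  ultimately show ?case using in' IH(3) by simp
qed

lemma K_least: "K = (LEAST i. L \<in> Lambda_pre g i)"
  by (simp add: K_idx_def Lambda_set_def)

lemma L_in_Lambda_K: "L \<in> Lambda_pre g K"
proof -
  have "\<exists>i. L \<in> Lambda_pre g i"
  proof (rule ccontr)
    assume none: "\<not> (\<exists>i. L \<in> Lambda_pre g i)"
    then have "Lambda_pre g (Suc L) \<subseteq> {..L}" "vertex (Suc L) \<in> Lambda_pre g (Suc L)"
      "Suc L \<le> vertex (Suc L)" using Lambda_pre_invariant[of "Suc L"] by auto
    then show False by (meson atMost_iff not_less_eq_eq order_refl order_trans subsetD)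
  qed
  then show ?thesis unfolding K_least by (rule LeastI_ex)
qed

lemma L_notin_Lambda: "i < K \<Longrightarrow> L \<notin> Lambda_pre g i"
  unfolding K_least by (auto dest: not_less_Least)

lemma Lambda_pre_le: "i \<le> K \<Longrightarrow> j \<in> Lambda_pre g i \<Longrightarrow> j \<le> L"
  and vertex_in: "i \<le> K \<Longrightarrow> vertex i \<in> Lambda_pre g i"
  using Lambda_pre_invariant[of i] L_notin_Lambda by auto

lemma vertex_le_L: "i \<le> K \<Longrightarrow> vertex i \<le> L"
  using Lambda_pre_le vertex_in by blast

lemma vertex_less_L: "i < K \<Longrightarrow> vertex i < L"
  using vertex_le_L[of i] vertex_in[of i] L_notin_Lambda[of i] by (cases "vertex i = L") auto

lemma Lambda_le_vertex:
  assumes "i \<le> K" "j \<in> Lambda_pre g i" shows "j \<le> vertex i"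
proof -
  have "Lambda_pre g i \<subseteq> {..L}" using Lambda_pre_le assms by auto
  then have "finite (Lambda_pre g i)" using finite_subset by blast
  then show ?thesis unfolding vertex_def using assms by (intro Max_ge)
qed

lemma vertex_0: "vertex 0 = 0"
  by (simp add: vertex_def)

lemma vertex_K: "vertex K = L"
  using Lambda_le_vertex[OF _ L_in_Lambda_K] vertex_le_L[of K] by auto

section \<open>Comparison of lines along the envelope\<close>

lemma Lambda_Suc_iff:
  assumes "i < K"
  shows "j \<in> Lambda_pre g (Suc i) \<longleftrightarrow> vertex i < j \<and> j \<le> L \<and> slope g (vertex i) j = breakpoint i"
  using Lambda_pre_Suc_eq[OF vertex_less_L[OF assms]] by blast

lemma vertex_Suc:
  assumes "i < K"
  shows "vertex i < vertex (Suc i)" "slope g (vertex i) (vertex (Suc i)) = breakpoint i"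
  using vertex_in[of "Suc i"] Lambda_Suc_iff assms by auto

lemma cost_vertex_Suc:
  assumes "i < K"
  shows "cost l (vertex i) < cost l (vertex (Suc i)) \<longleftrightarrow> breakpoint i < l"
    and "cost l (vertex (Suc i)) < cost l (vertex i) \<longleftrightarrow> l < breakpoint i"
  using cost_less_iff[OF vertex_Suc(1)[OF assms] vertex_le_L[of "Suc i"]] vertex_Suc(2)[OF assms] assms
  by auto

text \<open>The vertex after next lies beyond the maximum of \<open>Lambda_pre g (Suc i)\<close>, so
  at \<open>breakpoint i\<close> its line is strictly above that of \<open>vertex i\<close>. There
  the line of \<open>vertex (Suc i)\<close> is no higher than that of \<open>vertex i\<close>, hence
  its crossing with the later line comes strictly earlier.\<close>

lemma breakpoint_Suc_less:
  assumes "Suc i < K" shows "breakpoint (Suc i) < breakpoint i"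
proof -
  have "Lambda_pre g (Suc (Suc i)) \<noteq> {}" using vertex_in[of "Suc (Suc i)"] assms by auto
  then have j: "vertex (Suc i) < vertex (Suc (Suc i))" "vertex (Suc (Suc i)) \<le> L"
    "slope g (vertex (Suc i)) (vertex (Suc (Suc i))) = breakpoint (Suc i)"
    using vertex_Suc[OF assms] vertex_le_L[of "Suc (Suc i)"] assms by auto
  let ?j = "vertex (Suc (Suc i))" and ?l = "breakpoint i"
  have ij: "vertex i < ?j" using j vertex_Suc[of i] assms by auto
  have "?j \<notin> Lambda_pre g (Suc i)" using Lambda_le_vertex[of "Suc i" ?j] j assms by auto
  then have "slope g (vertex i) ?j < ?l"
    using Lambda_Suc_iff[of i ?j] slope_le_breakpoint[OF ij j(2)] ij j assms by auto
  then have "cost ?l (vertex i) < cost ?l ?j" using cost_less_iff[OF ij j(2)] by blast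
  moreover have "cost ?l (vertex (Suc i)) \<le> cost ?l (vertex i)"
    using cost_vertex_Suc(1)[of i ?l] assms by (simp add: not_less[symmetric])
  ultimately have "cost ?l (vertex (Suc i)) < cost ?l ?j" by linarith
  then show ?thesis using cost_less_iff[OF j(1,2)] j by auto
qed

text \<open>By maximality of the breakpoint, every later line crosses that of
  \<open>vertex i\<close> at or before it; those crossing exactly there form
  \<open>Lambda_pre g (Suc i)\<close>.\<close>

lemma cost_right:
  assumes "i < K" "vertex i < j" "j \<le> L" "breakpoint i \<le> l"
  shows "cost l (vertex i) \<le> cost l j"
    and "breakpoint i < l \<or> j \<notin> Lambda_pre g (Suc i) \<Longrightarrow> cost l (vertex i) < cost l j"
proof -
  have le: "slope g (vertex i) j \<le> breakpoint i" by (rule slope_le_breakpoint[OF assms(2,3)])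
  then show "cost l (vertex i) \<le> cost l j"
    unfolding cost_le_iff(1)[OF assms(2,3)] using assms(4) by linarith
  have "j \<notin> Lambda_pre g (Suc i) \<Longrightarrow> slope g (vertex i) j \<noteq> breakpoint i"
    using Lambda_Suc_iff[OF assms(1)] assms(2,3) by blast
  then show "breakpoint i < l \<or> j \<notin> Lambda_pre g (Suc i) \<Longrightarrow> cost l (vertex i) < cost l j"
    unfolding cost_less_iff(1)[OF assms(2,3)] using le assms(4) by linarith
qed

text \<open>At the breakpoint the two vertex lines agree and \<open>cost_right\<close> applies.
  Moving left favours the larger index, here \<open>vertex (Suc i)\<close>, so the inequality
  persists.\<close>

lemma cost_between:
  assumes "i < K" "vertex i < j" "j < vertex (Suc i)" "l \<le> breakpoint i"
  shows "cost l (vertex (Suc i)) \<le> cost l j"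
    and "l < breakpoint i \<or> j \<notin> Lambda_pre g (Suc i) \<Longrightarrow> cost l (vertex (Suc i)) < cost l j"
proof -
  let ?b = "breakpoint i"
  have le: "vertex (Suc i) \<le> L" "j \<le> L" using vertex_le_L[of "Suc i"] assms by auto
  have eq: "cost ?b (vertex (Suc i)) = cost ?b (vertex i)"
    using cost_vertex_Suc[OF assms(1), of ?b] by linarith
  have "?b \<le> slope g j (vertex (Suc i))"
    unfolding cost_le_iff(2)[OF assms(3) le(1), symmetric] eq
    by (rule cost_right(1)[OF assms(1,2) le(2) order_refl])
  moreover have "?b < slope g j (vertex (Suc i))" if "j \<notin> Lambda_pre g (Suc i)"
    unfolding cost_less_iff(2)[OF assms(3) le(1), symmetric] eq
    using cost_right(2)[OF assms(1,2) le(2) order_refl] that by blast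
  ultimately have "l \<le> slope g j (vertex (Suc i))"
    and strict: "l < breakpoint i \<or> j \<notin> Lambda_pre g (Suc i) \<Longrightarrow> l < slope g j (vertex (Suc i))"
    using assms(4) by linarith+
  then show "cost l (vertex (Suc i)) \<le> cost l j"
    using cost_le_iff(2)[OF assms(3) le(1)] by blast
  show "cost l (vertex (Suc i)) < cost l j"
    if "l < breakpoint i \<or> j \<notin> Lambda_pre g (Suc i)"
    using cost_less_iff(2)[OF assms(3) le(1)] strict[OF that] by blast
qed

text \<open>Counterpart of \<open>cost_right\<close> for earlier lines. The greedy choice only looks
  ahead, so this needs induction along all previous vertices.\<close>

lemma cost_left:
  assumes "i < K" "j < vertex (Suc i)" "l \<le> breakpoint i"
  shows "cost l (vertex (Suc i)) \<le> cost l j"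
    and "l < breakpoint i \<or> j \<notin> insert (vertex i) (Lambda_pre g (Suc i)) \<Longrightarrow>
      cost l (vertex (Suc i)) < cost l j"
proof -
  have "cost l (vertex (Suc i)) \<le> cost l j \<and>
    (l < breakpoint i \<or> j \<notin> insert (vertex i) (Lambda_pre g (Suc i)) \<longrightarrow>
      cost l (vertex (Suc i)) < cost l j)"
    using assms
  proof (induction i arbitrary: l)
    case 0
    then show ?case
      using cost_vertex_Suc[of 0 l] cost_between[of 0 j l] vertex_0 by (cases "j = 0") auto
  next
    case (Suc i)
    consider "j < vertex (Suc i)" | "j = vertex (Suc i)" | "vertex (Suc i) < j" by linarith
    then show ?case
    proof cases
      case 1
      \<comment> \<open>Decreasing breakpoints put \<open>l\<close> strictly left of the previous
        one, which gives the strict form of the induction hypothesis.\<close>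
      have "l < breakpoint i" using breakpoint_Suc_less[of i] Suc.prems by linarith
      then have "cost l (vertex (Suc i)) < cost l j" using Suc.IH[of l] 1 Suc.prems by auto
      moreover have "cost l (vertex (Suc (Suc i))) \<le> cost l (vertex (Suc i))"
        using cost_vertex_Suc(1)[of "Suc i" l] Suc.prems by (auto simp: not_less[symmetric])
      ultimately show ?thesis by linarith
    next
      case 2
      then show ?thesis using cost_vertex_Suc[of "Suc i" l] Suc.prems by (auto simp: not_less[symmetric])
    next
      case 3
      then show ?thesis using cost_between[of "Suc i" j l] Suc.prems by auto
    qed
  qed
  then show "cost l (vertex (Suc i)) \<le> cost l j"
    and "l < breakpoint i \<or> j \<notin> insert (vertex i) (Lambda_pre g (Suc i)) \<Longrightarrow>
      cost l (vertex (Suc i)) < cost l j" by auto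
qed

section \<open>Optimal indices for a given parameter\<close>

lemma not_opt: "cost l i < cost l k \<Longrightarrow> i \<le> L \<Longrightarrow> k \<notin> opt l"
  by (auto simp: opt_def not_le)

text \<open>The guards leave the interval of the first vertex unbounded above and that of the last
  unbounded below.\<close>

lemma vertex_in_opt:
  assumes "i \<le> K" "i < K \<Longrightarrow> breakpoint i \<le> l" "0 < i \<Longrightarrow> l \<le> breakpoint (i - 1)"
  shows "vertex i \<in> opt l"
proof -
  have "cost l (vertex i) \<le> cost l j" if "j \<le> L" for j
  proof (cases j "vertex i" rule: linorder_cases)
    case less
    then have "0 < i" using vertex_0 by (cases i) auto
    then show ?thesis using cost_left(1)[of "i - 1" j l] less assms by auto
  next
    case greater
    then have "i < K" using assms(1) that vertex_K by (cases "i = K") auto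
    then show ?thesis using cost_right(1) greater that assms by blast
  qed auto
  then show ?thesis using vertex_le_L assms by (auto simp: opt_def)
qed

text \<open>Outside the closed interval an adjacent vertex is strictly cheaper.\<close>

lemma vertex_in_opt_iff:
  assumes "i < K"
  shows "vertex i \<in> opt l \<longleftrightarrow> breakpoint i \<le> l \<and> (0 < i \<longrightarrow> l \<le> breakpoint (i - 1))"
proof -
  have "vertex i \<notin> opt l" if "l < breakpoint i"
    using cost_vertex_Suc(2)[OF assms] not_opt[OF _ vertex_le_L[of "Suc i"]] that assms by simp
  moreover have "vertex i \<notin> opt l" if "0 < i" "breakpoint (i - 1) < l"
    using cost_vertex_Suc(1)[of "i - 1" l] not_opt[OF _ vertex_le_L[of "i - 1"]] that assms by simp
  ultimately show ?thesis using vertex_in_opt[of i l] assms by force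
qed

lemma opt_singleton:
  assumes "i < K" "breakpoint i < l" "0 < i \<Longrightarrow> l < breakpoint (i - 1)"
  shows "opt l = {vertex i}"
proof -
  have "j \<notin> opt l" if "j \<le> L" "j \<noteq> vertex i" for j
  proof (cases "j < vertex i")
    case True
    then have "0 < i" using vertex_0 by (cases i) auto
    then have "cost l (vertex i) < cost l j" using cost_left(2)[of "i - 1" j l] True assms by auto
    then show ?thesis using not_opt vertex_le_L assms by auto
  next
    case False
    then have "cost l (vertex i) < cost l j" using cost_right(2)[of i j l] that assms by auto
    then show ?thesis using not_opt vertex_le_L assms by auto
  qed
  moreover have "vertex i \<in> opt l" using vertex_in_opt assms by force
  ultimately show ?thesis by (auto simp: opt_def)
qed

text \<open>The closed intervals of consecutive vertices share the endpoint
  \<open>breakpoint i\<close>. This tie later makes the inclusion in (i) strict.\<close>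

lemma vertices_in_opt:
  assumes "i < K"
  shows "vertex i \<in> opt (breakpoint i)" "vertex (Suc i) \<in> opt (breakpoint i)"
proof -
  have "breakpoint i < breakpoint (i - 1)" if "0 < i"
    using breakpoint_Suc_less[of "i - 1"] that assms by auto
  then show "vertex i \<in> opt (breakpoint i)" using vertex_in_opt[of i] assms by force
  show "vertex (Suc i) \<in> opt (breakpoint i)"
    using vertex_in_opt[of "Suc i" "breakpoint i"] breakpoint_Suc_less[of i] assms by force
qed

text \<open>Left of the breakpoint the next vertex beats \<open>k\<close>, right of it the current
  one does; at the breakpoint \<open>k\<close> survives only if its line passes through the crossing
  of the two vertex lines.\<close>

lemma between_in_opt_iff:
  assumes "i < K" "vertex i < k" "k < vertex (Suc i)"
  shows "k \<in> opt l \<longleftrightarrow> l = breakpoint i \<and> k \<in> Lambda_pre g (Suc i)"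
proof -
  have le: "vertex (Suc i) \<le> L" using vertex_le_L[of "Suc i"] assms by auto
  then have "k \<le> L" "vertex i \<le> L" using assms by auto
  have "k \<notin> opt l" if "l < breakpoint i \<or> l \<le> breakpoint i \<and> k \<notin> Lambda_pre g (Suc i)"
    using cost_between(2)[OF assms, of l] not_opt[OF _ le] that by auto
  moreover have "k \<notin> opt l" if "breakpoint i < l"
    using cost_right(2)[OF assms(1,2) \<open>k \<le> L\<close>, of l] not_opt[OF _ \<open>vertex i \<le> L\<close>] that by auto
  moreover have "k \<in> opt l" if "l = breakpoint i" "k \<in> Lambda_pre g (Suc i)"
  proof -
    have "slope g (vertex i) k = l" using Lambda_Suc_iff[OF assms(1)] that by blast
    then have "cost l k \<le> cost l (vertex i)"
      using cost_le_iff(2)[OF assms(2) \<open>k \<le> L\<close>] by simp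
    then show ?thesis
      using vertices_in_opt(1)[OF assms(1)] that(1) \<open>k \<le> L\<close> by (auto simp: opt_def intro: order_trans)
  qed
  ultimately show ?thesis by (cases l "breakpoint i" rule: linorder_cases) auto
qed

lemma between_vertices:
  assumes "k \<le> L" "k \<notin> vertex ` {..K}"
  shows "\<exists>i<K. vertex i < k \<and> k < vertex (Suc i)"
proof -
  let ?P = "\<lambda>i. k \<le> vertex i"
  define j where "j = (LEAST i. ?P i)"
  have "?P K" using assms(1) vertex_K by simp
  then have k: "k \<le> vertex j" and "j \<le> K"
    unfolding j_def by (rule LeastI[of ?P], rule Least_le[of ?P])
  then have ne: "k \<noteq> vertex j" using assms(2) by blast
  then obtain i where i: "j = Suc i" using k vertex_0 by (cases j) auto
  then have "\<not> k \<le> vertex i" using not_less_Least[of i ?P] by (simp add: j_def)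
  then show ?thesis using k ne i \<open>j \<le> K\<close> by (intro exI[of _ i]) auto
qed

lemma Lambda_interior:
  assumes "i < K" "k \<in> Lambda_pre g (Suc i)" "k \<notin> vertex ` {..K}"
  shows "vertex i < k" "k < vertex (Suc i)"
proof -
  show "vertex i < k" using Lambda_Suc_iff[OF assms(1)] assms(2) by blast
  have "k \<noteq> vertex (Suc i)" using assms by auto
  then show "k < vertex (Suc i)" using Lambda_le_vertex[of "Suc i" k] assms by auto
qed

text \<open>The second optimal index contributes a nonempty piece of different sparsity, hence
  disjoint from the first.\<close>

lemma Omega_seq_psubset_reg:
  assumes "0 < l" "k \<in> opt l" "k' \<in> opt l" "k \<noteq> k'"
  shows "Omega_seq g k \<subset> Omega_reg g l"
proof -
  have "s k \<noteq> s k'" using assms s_inj by (auto simp: opt_def)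
  then have "Omega_seq g k \<inter> Omega_seq g k' = {}" by (auto simp: Omega_seq_eq)
  then show ?thesis unfolding Omega_reg_eq[OF assms(1)]
    using assms Omega_seq_nonempty[of k'] by blast
qed

section \<open>Back to the original indexing: the three cases\<close>

lemma t_seq_eq: "i \<le> K \<Longrightarrow> t_seq g i = vertex i"
  by (cases "i < K") (simp_all add: t_seq_def Lambda_set_def vertex_def[symmetric] vertex_K)

lemma T_set_eq: "T_set g = vertex ` {..K}"
  unfolding T_set_def atLeast0AtMost by (intro image_cong) (simp_all add: t_seq_eq)

lemma lambda_val_eq: "i < K \<Longrightarrow> lambda_val g (int i) = ereal (breakpoint i)"
  by (simp add: lambda_val_def breakpoint_def t_seq_eq)

lemma lambda_val_pred:
  "i < K \<Longrightarrow> lambda_val g (int i - 1) = (if i = 0 then \<infinity> else ereal (breakpoint (i - 1)))"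
  using lambda_val_eq[of "i - 1"] by (cases i) (auto simp: lambda_val_def)

lemma vertex_regime:
  assumes k: "k < L" "\<rho> k \<le> r" "r < \<rho> (Suc k)" and j: "j \<le> K" "k = t_seq g j" and l: "0 < l"
  defines "C \<equiv> argmin_on l0 {x. g x \<le> r}"
  shows "ereal l \<in> {lambda_val g (int j)<..<lambda_val g (int j - 1)} \<Longrightarrow> Omega_reg g l \<subseteq> C"
    and "ereal l = lambda_val g (int j) \<or> ereal l = lambda_val g (int j - 1) \<Longrightarrow>
      Omega_reg g l \<inter> C = Omega_seq g k"
    and "ereal l \<notin> {lambda_val g (int j)<..<lambda_val g (int j - 1)} \<Longrightarrow>
      ereal l \<noteq> lambda_val g (int j) \<Longrightarrow> ereal l \<noteq> lambda_val g (int j - 1) \<Longrightarrow>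
      Omega_reg g l \<inter> C = {}"
    and "r = \<rho> k \<Longrightarrow> ereal l \<in> {lambda_val g (int j)<..<lambda_val g (int j - 1)} \<Longrightarrow>
      Omega_reg g l = C"
    and "r = \<rho> k \<Longrightarrow> ereal l = lambda_val g (int j) \<or> ereal l = lambda_val g (int j - 1) \<Longrightarrow>
      C \<subset> Omega_reg g l"
proof -
  have vk: "k = vertex j" using j t_seq_eq by simp
  \<comment> \<open>The last vertex is \<open>L\<close>, excluded by \<open>k < L\<close>, so
    \<open>breakpoint j\<close> is a genuine finite value.\<close>
  then have jK: "j < K" using j k vertex_K by (cases "j = K") auto
  note lv = lambda_val_eq[OF jK] lambda_val_pred[OF jK]
  note inter = reg_inter_constrained[OF l k, folded C_def]
  have less: "0 < j \<Longrightarrow> breakpoint j < breakpoint (j - 1)"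
    using breakpoint_Suc_less[of "j - 1"] jK by auto
  have single: "Omega_reg g l = Omega_seq g k"
    if "ereal l \<in> {lambda_val g (int j)<..<lambda_val g (int j - 1)}"
    using opt_singleton[OF jK, of l] that lv vk Omega_reg_eq[OF l] by (auto split: if_splits)
  show "Omega_reg g l \<subseteq> C" if "ereal l \<in> {lambda_val g (int j)<..<lambda_val g (int j - 1)}"
    using single[OF that] constrained_eq[OF k] k(2) by (auto simp: C_def Omega_seq_eq)
  show "Omega_reg g l \<inter> C = Omega_seq g k"
    if "ereal l = lambda_val g (int j) \<or> ereal l = lambda_val g (int j - 1)"
    using inter vertex_in_opt_iff[OF jK, of l] vk that lv less by (auto split: if_splits)
  show "Omega_reg g l \<inter> C = {}"
    if "ereal l \<notin> {lambda_val g (int j)<..<lambda_val g (int j - 1)}"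
      "ereal l \<noteq> lambda_val g (int j)" "ereal l \<noteq> lambda_val g (int j - 1)"
    using inter vertex_in_opt_iff[OF jK, of l] vk that lv by (auto split: if_splits)
  assume "r = \<rho> k"
  then have C: "C = Omega_seq g k" using constrained_at_level k by (simp add: C_def)
  show "Omega_reg g l = C" if "ereal l \<in> {lambda_val g (int j)<..<lambda_val g (int j - 1)}"
    using single[OF that] C by simp
  show "C \<subset> Omega_reg g l"
    if "ereal l = lambda_val g (int j) \<or> ereal l = lambda_val g (int j - 1)"
  proof (cases "l = breakpoint j")
    case True
    then show ?thesis unfolding C vk using vertices_in_opt[OF jK] vertex_Suc(1)[OF jK] l
      by (intro Omega_seq_psubset_reg[of _ _ "vertex (Suc j)"]) auto
  next
    case False
    \<comment> \<open>For \<open>j = 0\<close> the upper end is infinite and cannot equal a real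
      \<open>l\<close>; the tie is therefore with the preceding vertex.\<close>
    then have "0 < j" "l = breakpoint (j - 1)" using that lv by (auto split: if_splits)
    then obtain i where "j = Suc i" "l = breakpoint i" by (cases j) auto
    then show ?thesis unfolding C vk
      using vertices_in_opt[of i] vertex_Suc(1)[of i] l jK
      by (intro Omega_seq_psubset_reg[of _ _ "vertex i"]) auto
  qed
qed

lemma edge_regime:
  assumes k: "k < L" "\<rho> k \<le> r" "r < \<rho> (Suc k)"
    and j: "j \<in> {-1..int K - 1}" "k \<in> Lambda_set g j - T_set g" and l: "0 < l"
  shows "ereal l = lambda_val g j \<Longrightarrow> Omega_reg g l \<inter> argmin_on l0 {x. g x \<le> r} = Omega_seq g k"
    and "ereal l \<noteq> lambda_val g j \<Longrightarrow> Omega_reg g l \<inter> argmin_on l0 {x. g x \<le> r} = {}"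
proof -
  \<comment> \<open>\<open>Lambda_set g (-1)\<close> is \<open>{0}\<close>, and 0 is the first
    vertex, hence in \<open>T_set g\<close>.\<close>
  have "j \<noteq> -1" using j vertex_0 by (auto simp: Lambda_set_def T_set_eq)
  then have "0 \<le> j" using j(1) by simp
  then obtain i where i: "j = int i" by (rule nonneg_int_cases)
  then have iK: "i < K" and kL: "k \<in> Lambda_pre g (Suc i)" using j
    by (auto simp: Lambda_set_def nat_add_distrib)
  have "k \<notin> vertex ` {..K}" using j T_set_eq by simp
  from between_in_opt_iff[OF iK Lambda_interior[OF iK kL this], of l]
  show "ereal l = lambda_val g j \<Longrightarrow> Omega_reg g l \<inter> argmin_on l0 {x. g x \<le> r} = Omega_seq g k"
    and "ereal l \<noteq> lambda_val g j \<Longrightarrow> Omega_reg g l \<inter> argmin_on l0 {x. g x \<le> r} = {}"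
    using reg_inter_constrained[OF l k] lambda_val_eq[OF iK] kL i by simp_all
qed

lemma no_regime:
  assumes k: "k < L" "\<rho> k \<le> r" "r < \<rho> (Suc k)"
    and none: "k \<notin> (\<Union>i\<in>{-1..int K - 1}. Lambda_set g i)" and l: "0 < l"
  shows "Omega_reg g l \<inter> argmin_on l0 {x. g x \<le> r} = {}"
proof -
  have notin: "k \<notin> Lambda_pre g i" if "i \<le> K" for i
  proof -
    have "int i - 1 \<in> {-1..int K - 1}" using that by auto
    then have "k \<notin> Lambda_set g (int i - 1)" using none by blast
    then show ?thesis by (simp add: Lambda_set_def)
  qed
  then have "k \<notin> vertex ` {..K}" using vertex_in by auto
  then obtain i where i: "i < K" "vertex i < k" "k < vertex (Suc i)"
    using between_vertices[of k] k by auto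
  then have "k \<notin> opt l" using between_in_opt_iff[OF i] notin[of "Suc i"] by auto
  then show ?thesis using reg_inter_constrained[OF l k] by simp
qed

end

section \<open>Attainment for the least-residual problem\<close>

lemma pnorm_nonneg: "0 < p \<Longrightarrow> 0 \<le> pnorm p y"
  unfolding pnorm_def by (intro real_root_ge_zero sum_nonneg) auto

lemma pnorm_minus: "pnorm p (- y) = pnorm p y"
  by (simp add: pnorm_def)

lemma pnorm_1: "pnorm 1 = (\<lambda>y. \<Sum>i\<in>UNIV. \<bar>y $ i\<bar>)"
  by (simp add: pnorm_def fun_eq_iff)

lemma pnorm_2: "pnorm 2 = norm"
  by (simp add: pnorm_def norm_vec_def L2_set_def sqrt_def fun_eq_iff)

lemma continuous_on_pnorm:
  fixes S :: "(real ^ 'm) set"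
  assumes "p \<in> {1, 2}" shows "continuous_on S (pnorm p)"
proof (cases "p = 1")
  case True
  have "continuous_on S (\<lambda>y. \<Sum>i\<in>UNIV. \<bar>y $ i\<bar>)" by (intro continuous_intros)
  then show ?thesis unfolding True pnorm_1 .
next
  case False
  then have "p = 2" using assms by auto
  then show ?thesis using continuous_on_norm_id[of S] by (simp add: pnorm_2)
qed

text \<open>Supplies boundedness of the sublevel sets of \<open>pnorm p\<close> for the compactness
  argument.\<close>

lemma norm_le_pnorm: "p \<in> {1, 2} \<Longrightarrow> norm y \<le> pnorm p y"
  using norm_le_l1_cart[of y] by (auto simp: pnorm_1[simplified] pnorm_2)

lemma phi_le_iff:
  assumes "0 < p" "0 \<le> y" "0 \<le> z" shows "phi p y \<le> phi p z \<longleftrightarrow> y \<le> z"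
  using assms by (simp add: phi_def divide_le_cancel)

text \<open>Sparse vectors form a finite union of coordinate subspaces; a linear image of a subspace
  is a subspace, hence closed, and finite unions and translations keep this.\<close>

lemma closed_residuals_sparse:
  fixes A :: "real ^ 'n ^ 'm"
  shows "closed ((\<lambda>x. A *v x - b) ` {x. l0 x \<le> k})"
proof -
  have sub: "{x. l0 x \<le> k} = (\<Union>I\<in>{I. card I \<le> k}. {x :: real ^ 'n. \<forall>i. i \<notin> I \<longrightarrow> x $ i = 0})"
  proof safe
    fix x :: "real ^ 'n" assume "l0 x \<le> k"
    then show "x \<in> (\<Union>I\<in>{I. card I \<le> k}. {x. \<forall>i. i \<notin> I \<longrightarrow> x $ i = 0})"
      by (intro UN_I[of "{i. x $ i \<noteq> 0}"]) (auto simp: l0_def)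
  next
    fix x :: "real ^ 'n" and I assume *: "card I \<le> k" "\<forall>i. i \<notin> I \<longrightarrow> x $ i = 0"
    then have "card {i. x $ i \<noteq> 0} \<le> card I" by (intro card_mono) auto
    then show "l0 x \<le> k" using * by (simp add: l0_def)
  qed
  have "closed ((\<lambda>x. A *v x) ` {x. \<forall>i. i \<notin> I \<longrightarrow> x $ i = 0})" for I
    by (intro closed_subspace linear_subspace_image matrix_vector_mul_linear)
      (auto simp: subspace_def)
  then have "closed ((\<lambda>y. y - b) ` (\<Union>I\<in>{I. card I \<le> k}. (\<lambda>x. A *v x) ` {x. \<forall>i. i \<notin> I \<longrightarrow> x $ i = 0}))"
    by (intro closed_translation_subtract closed_UN) auto
  then show ?thesis unfolding sub by (simp add: image_UN image_image)
qed

text \<open>The minimum is sought over residuals rather than over \<open>x\<close>: a kernel of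
  \<open>A\<close> may make sublevel sets in \<open>x\<close> unbounded, while the closed set of
  residuals can be cut down to a compact one.\<close>

lemma residual_attained:
  fixes A :: "real ^ 'n ^ 'm"
  assumes "p \<in> {1, 2}"
  shows "\<exists>x. l0 x \<le> k \<and> (\<forall>y. l0 y \<le> k \<longrightarrow> pnorm p (A *v x - b) \<le> pnorm p (A *v y - b))"
proof -
  let ?C = "(\<lambda>x. A *v x - b) ` {x. l0 x \<le> k}"
  \<comment> \<open>The residual \<open>- b\<close> of the zero vector is always available, so
    residuals of Euclidean norm above \<open>pnorm p (- b)\<close> cannot be better.\<close>
  let ?B = "?C \<inter> cball 0 (pnorm p (- b))"
  have "l0 (0 :: real ^ 'n) \<le> k" using l0_eq_0_iff[of "0 :: real ^ 'n"] by simp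
  then have 0: "- b \<in> ?B" using norm_le_pnorm[OF assms, of "- b"]
    by (auto intro!: image_eqI[of _ _ 0])
  moreover have "compact ?B" using closed_residuals_sparse by (intro closed_Int_compact) auto
  ultimately obtain z where z: "z \<in> ?B" "\<forall>y\<in>?B. pnorm p z \<le> pnorm p y"
    using continuous_attains_inf[OF _ _ continuous_on_pnorm[OF assms], of ?B] by blast
  have "pnorm p z \<le> pnorm p y" if "y \<in> ?C" for y
  proof (cases "y \<in> ?B")
    case False
    then have "pnorm p (- b) < norm y" using that by auto
    moreover have "pnorm p z \<le> pnorm p (- b)" using z(2) 0 by blast
    ultimately show ?thesis using norm_le_pnorm[OF assms, of y] by linarith
  qed (use z in auto)
  then show ?thesis using z(1) by auto
qed

theorem theorem4p1:
  fixes A :: "real ^ 'n ^ 'm" and b :: "real ^ 'm" and p :: nat and \<sigma> :: real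
    and g :: "real ^ 'n \<Rightarrow> real"
  assumes "p \<in> {1, 2}"
  defines "g \<equiv> \<lambda>x. phi p (pnorm p (A *v x - b))"
  assumes "\<sigma> \<in> {sigma_star A b p..<pnorm p b}"
  shows "(\<exists>!k. k < L_idx g \<and> rho g k \<le> phi p \<sigma> \<and> phi p \<sigma> < rho g (k + 1)) \<and>
    (\<forall>k. k < L_idx g \<and> rho g k \<le> phi p \<sigma> \<and> phi p \<sigma> < rho g (k + 1) \<longrightarrow>
      \<comment> \<open>(i)\<close>
      (\<forall>j \<le> K_idx g. k = t_seq g j \<longrightarrow>
        (\<forall>l::real. l > 0 \<longrightarrow>
          (ereal l \<in> {lambda_val g (int j)<..<lambda_val g (int j - 1)} \<longrightarrow>
             Omega_reg g l \<subseteq> Omega_con A b p \<sigma>) \<and>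
          (ereal l = lambda_val g (int j) \<or> ereal l = lambda_val g (int j - 1) \<longrightarrow>
             Omega_reg g l \<inter> Omega_con A b p \<sigma> = Omega_seq g k) \<and>
          (ereal l \<notin> {lambda_val g (int j)<..<lambda_val g (int j - 1)} \<and>
           ereal l \<noteq> lambda_val g (int j) \<and> ereal l \<noteq> lambda_val g (int j - 1) \<longrightarrow>
             Omega_reg g l \<inter> Omega_con A b p \<sigma> = {}) \<and>
          (phi p \<sigma> = rho g k \<longrightarrow>
            (ereal l \<in> {lambda_val g (int j)<..<lambda_val g (int j - 1)} \<longrightarrow>
               Omega_reg g l = Omega_con A b p \<sigma>) \<and>
            (ereal l = lambda_val g (int j) \<or> ereal l = lambda_val g (int j - 1) \<longrightarrow>
               Omega_con A b p \<sigma> \<subset> Omega_reg g l)))) \<and>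
      \<comment> \<open>(ii)\<close>
      (\<forall>j \<in> {-1..int (K_idx g) - 1}. k \<in> Lambda_set g j - T_set g \<longrightarrow>
        (\<forall>l::real. l > 0 \<longrightarrow>
          (ereal l = lambda_val g j \<longrightarrow>
             Omega_reg g l \<inter> Omega_con A b p \<sigma> = Omega_seq g k) \<and>
          (ereal l \<noteq> lambda_val g j \<longrightarrow>
             Omega_reg g l \<inter> Omega_con A b p \<sigma> = {}))) \<and>
      \<comment> \<open>(iii)\<close>
      (k \<notin> (\<Union>i\<in>{-1..int (K_idx g) - 1}. Lambda_set g i) \<longrightarrow>
        (\<forall>l::real. l > 0 \<longrightarrow>
          Omega_reg g l \<inter> Omega_con A b p \<sigma> = {})))"
proof -
  have p: "0 < p" using assms(1) by auto
  have g_le: "g x \<le> phi p z \<longleftrightarrow> pnorm p (A *v x - b) \<le> z" if "0 \<le> z" for x z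
    unfolding g_def by (intro phi_le_iff p pnorm_nonneg that)
  have g_mono: "g x \<le> g y \<longleftrightarrow> pnorm p (A *v x - b) \<le> pnorm p (A *v y - b)" for x y
    using g_le[OF pnorm_nonneg[OF p], of x "A *v y - b"] by (simp add: g_def)
  interpret sparse_attaining g
    by unfold_locales (simp add: g_mono residual_attained[OF assms(1)])
  obtain z where z: "g z = rho g 0" "\<forall>y. g z \<le> g y" using rho_0_attained by blast
  then have "pnorm p (A *v z - b) \<le> pnorm p (A *v y - b)" for y using g_mono by blast
  then have "sigma_star A b p = pnorm p (A *v z - b)"
    unfolding sigma_star_def by (intro min_on_eqI) auto
  then have \<sigma>: "pnorm p (A *v z - b) \<le> \<sigma>" "\<sigma> < pnorm p b" using assms(3) by auto
  then have "0 \<le> \<sigma>" using pnorm_nonneg[OF p] order_trans by blast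
  have lo: "rho g 0 \<le> phi p \<sigma>" using g_le[OF \<open>0 \<le> \<sigma>\<close>, of z] \<sigma> z by simp
  \<comment> \<open>The zero vector realises the last level: \<open>g 0 = rho g L\<close>, and its
    residual norm \<open>pnorm p b\<close> exceeds \<open>\<sigma>\<close>.\<close>
  have hi: "phi p \<sigma> < rho g L"
    using g_le[OF \<open>0 \<le> \<sigma>\<close>, of 0] \<sigma> by (simp add: rho_L pnorm_minus)
  have con: "Omega_con A b p \<sigma> = argmin_on l0 {x. g x \<le> phi p \<sigma>}"
    by (simp add: Omega_con_def g_le[OF \<open>0 \<le> \<sigma>\<close>])
  have unique: "\<exists>!k. k < L \<and> rho g k \<le> phi p \<sigma> \<and> phi p \<sigma> < rho g (Suc k)"
    using bracket_exists[OF lo hi] bracket_unique[where r = "phi p \<sigma>"] by blast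
  show ?thesis
    unfolding con Suc_eq_plus1[symmetric]
    apply (rule conjI[OF unique], rule allI, rule impI, elim conjE)
    apply (intro conjI allI impI ballI)
           apply (rule vertex_regime(1); assumption)
          apply (rule vertex_regime(2); assumption)
         apply (rule vertex_regime(3); (elim conjE)?; assumption)
        apply (rule vertex_regime(4); assumption)
       apply (rule vertex_regime(5); assumption)
      apply (rule edge_regime(1); assumption)
     apply (rule edge_regime(2); assumption)
    apply (rule no_regime; assumption)
    done
qed

end
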